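(* Let $Y^{n}=(Y_{1},\ldots,Y_{n})$ with $Y_{i}\overset{\mathrm{iid}}{\sim}\mathbb{P}_{\theta}\in\mathcal{P}_{\Theta}$, where $\mathcal{P}_{\Theta}$ is an identifiable family of distributions that is Laplace-regular (definition in the context). In particular $\mathcal{P}_{\Theta}$ admits densities $f(y^{n}\mid\theta)$ with respect to Lebesgue measure that are six times continuously differentiable in $\theta$ at the data-governing parameter $\theta\in\Theta\subset\mathbb{R}^{p}$, with $\Theta$ open with non-empty interior. Assume furthermore that the prior densities $\pi(\theta\mid\mathcal{H}_{\widetilde{0}})$ (peri-null) and $\pi(\theta\mid\mathcal{H}_{1})$ (alternative) on $\Theta$ assign positive mass to a neighborhood at the data-governing parameter $\theta$ and are four times continuously differentiable at $\theta$. Then, as $n\to\infty$, $$\mathrm{BF}_{1\widetilde{0}}(Y^{n})\ \overset{\mathbb{P}_{\theta}}{\longrightarrow}\ \frac{\pi(\theta\mid\mathcal{H}_{1})}{\pi(\theta\mid\mathcal{H}_{\widetilde{0}})}.$$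
   Context: The alternative hypothesis $\mathcal{H}_{1}$ and the peri-null hypothesis $\mathcal{H}_{\widetilde{0}}$ use the same parameter space $\Theta\subset\mathbb{R}^{p}$ and the same likelihood $f(y^{n}\mid\theta)=\prod_{i=1}^{n}f(y_{i}\mid\theta)$; they differ only in their prior densities $\pi(\cdot\mid\mathcal{H}_{1})$ and $\pi(\cdot\mid\mathcal{H}_{\widetilde{0}})$ on $\Theta$. The marginal likelihoods are $p(y^{n}\mid\mathcal{H}_{j})=\int_{\Theta}f(y^{n}\mid\theta)\,\pi(\theta\mid\mathcal{H}_{j})\,\mathrm{d}\theta$ for $j\in\{\widetilde{0},1\}$, and the peri-null Bayes factor is $\mathrm{BF}_{1\widetilde{0}}(y^{n})=p(y^{n}\mid\mathcal{H}_{1})/p(y^{n}\mid\mathcal{H}_{\widetilde{0}})$. The notation $X_{n}\overset{\mathbb{P}_{\theta}}{\to}X$ means convergence in probability: $\lim_{n\to\infty}\mathbb{P}_{\theta}(|X_{n}-X|>\epsilon)=0$ for all $\epsilon>0$. Laplace-regular (in the sense of Kass, Tierney and Kadane, 1990): write $\ell_{n}(\theta)=\sum_{i=1}^{n}\log f(Y_{i}\mid\theta)$. The family is Laplace-regular if $\ell_{n}$ is six times continuously differentiable on $\Theta$ and for every $\theta_{0}\in\Theta$ there exist $\varepsilon,M,\eta>0$ with $B_{\varepsilon}(\theta_{0})\subset\Theta$ (open ball) such that, with $\mathbb{P}_{\theta_{0}}$-probability one: (i) $\limsup_{n}\sup_{\theta\in B_{\varepsilon}(\theta_{0})}n^{-1}|\partial_{j_{1}\cdots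 j_{d}}\ell_{n}(\theta)|<M$ for all $0\le d\le 6$ and $1\le j_{1},\ldots,j_{d}\le p$; (ii) $\liminf_{n}\inf_{\theta\in B_{\varepsilon}(\theta_{0})}\det(-n^{-1}D^{2}\ell_{n}(\theta))>\eta$; (iii) for every $\delta>0$ with $B_{\delta}(\theta_{0})\subset\Theta$, $\limsup_{n}\sup_{\theta\in\Theta\setminus B_{\delta}(\theta_{0})}n^{-1}[\ell_{n}(\theta)-\ell_{n}(\theta_{0})]<0$. *)

theory Defs
  imports "HOL-Probability.Probability"
begin

subsection \<open>Continuously differentiable functions of several variables\<close>

definition partial_deriv :: "'p::finite \<Rightarrow> (real^'p \<Rightarrow> real) \<Rightarrow> real^'p \<Rightarrow> real" where
  "partial_deriv j F x = deriv (\<lambda>t. F (x + t *\<^sub>R axis j 1)) 0"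

fun partial_derivs :: "'p::finite list \<Rightarrow> (real^'p \<Rightarrow> real) \<Rightarrow> real^'p \<Rightarrow> real" where
  "partial_derivs [] F = F"
| "partial_derivs (j # js) F = partial_deriv j (partial_derivs js F)"

text \<open>Meant for open \<open>U\<close> only: the difference quotients also use values of \<open>F\<close> near \<open>x\<close>.\<close>

definition cont_diff_on :: "nat \<Rightarrow> (real^'p::finite \<Rightarrow> real) \<Rightarrow> (real^'p) set \<Rightarrow> bool" where
  "cont_diff_on k F U \<longleftrightarrow>
     (\<forall>js. length js < k \<longrightarrow>
        (\<forall>j. \<forall>x\<in>U. (\<lambda>t. partial_derivs js F (x + t *\<^sub>R axis j 1)) differentiable (at 0))) \<and>
     (\<forall>js. length js \<le> k \<longrightarrow> continuous_on U (partial_derivs js F))"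

definition cont_diff_at :: "nat \<Rightarrow> (real^'p::finite \<Rightarrow> real) \<Rightarrow> real^'p \<Rightarrow> bool" where
  "cont_diff_at k F x \<longleftrightarrow> (\<exists>U. open U \<and> x \<in> U \<and> cont_diff_on k F U)"

definition hessian :: "(real^'p::finite \<Rightarrow> real) \<Rightarrow> real^'p \<Rightarrow> real^'p^'p" where
  "hessian F x = (\<chi> i j. partial_derivs [i, j] F x)"

subsection \<open>Probability densities with respect to Lebesgue measure\<close>

definition prob_density_on :: "'a::euclidean_space set \<Rightarrow> ('a \<Rightarrow> real) \<Rightarrow> bool" where
  "prob_density_on S g \<longleftrightarrow>
     S \<in> sets borel \<and> g \<in> borel_measurable (restrict_space lborel S) \<and> (\<forall>x\<in>S. 0 \<le> g x) \<and>
     (\<integral>\<^sup>+ x. ennreal (g x) \<partial>restrict_space lborel S) = 1"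

definition density_law :: "'a::euclidean_space set \<Rightarrow> ('a \<Rightarrow> real) \<Rightarrow> 'a measure" where
  "density_law S g = density (restrict_space lborel S) (\<lambda>x. ennreal (g x))"

subsection \<open>Parametric models\<close>

text \<open>
  A model consists of a sample space \<open>X\<close> for a single observation, a parameter space \<open>\<Theta>\<close> and
  the densities \<open>f y \<theta>\<close>, that is \<open>f(y | \<theta>)\<close>. Only the values of \<open>f\<close> on \<open>X \<times> \<Theta>\<close> matter.
  The observations are numbered from 0, so that the data of size \<open>n\<close> are \<open>y 0, \<dots>, y (n - 1)\<close>.
\<close>

definition model_law ::
  "'y::euclidean_space set \<Rightarrow> ('y \<Rightarrow> real^'p::finite \<Rightarrow> real) \<Rightarrow> real^'p \<Rightarrow> 'y measure" where
  "model_law X f \<theta> = density_law X (\<lambda>y. f y \<theta>)"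

definition identifiable ::
  "'y::euclidean_space set \<Rightarrow> (real^'p::finite) set \<Rightarrow> ('y \<Rightarrow> real^'p \<Rightarrow> real) \<Rightarrow> bool" where
  "identifiable X \<Theta> f \<longleftrightarrow> inj_on (model_law X f) \<Theta>"

definition likelihood ::
  "('y \<Rightarrow> real^'p::finite \<Rightarrow> real) \<Rightarrow> nat \<Rightarrow> (nat \<Rightarrow> 'y) \<Rightarrow> real^'p \<Rightarrow> real" where
  "likelihood f n y \<theta> = (\<Prod>i<n. f (y i) \<theta>)"

definition log_likelihood ::
  "('y \<Rightarrow> real^'p::finite \<Rightarrow> real) \<Rightarrow> nat \<Rightarrow> (nat \<Rightarrow> 'y) \<Rightarrow> real^'p \<Rightarrow> real" where
  "log_likelihood f n y \<theta> = (\<Sum>i<n. ln (f (y i) \<theta>))"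

text \<open>
  Positivity of \<open>f\<close> on \<open>X \<times> \<Theta>\<close> says that the log-likelihood is a genuine real-valued
  function on \<open>\<Theta>\<close>; it has to be stated because \<open>ln 0 = 0\<close> in HOL. Suprema, infima and
  upper and lower limits are taken in the extended reals, so that they always exist; in
  particular the supremum over an empty set is \<open>-\<infinity>\<close>.
\<close>

definition laplace_regular ::
  "'y::euclidean_space set \<Rightarrow> (real^'p::finite) set \<Rightarrow> ('y \<Rightarrow> real^'p \<Rightarrow> real) \<Rightarrow> bool" where
  "laplace_regular X \<Theta> f \<longleftrightarrow>
     (\<forall>y\<in>X. \<forall>\<theta>\<in>\<Theta>. 0 < f y \<theta>) \<and>
     (\<forall>n y. (\<forall>i. y i \<in> X) \<longrightarrow> cont_diff_on 6 (log_likelihood f n y) \<Theta>) \<and>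
     (\<forall>\<theta>\<^sub>0\<in>\<Theta>. \<exists>\<epsilon>>0. \<exists>K>0. \<exists>\<eta>>0. ball \<theta>\<^sub>0 \<epsilon> \<subseteq> \<Theta> \<and>
        (AE y in (\<Pi>\<^sub>M i\<in>(UNIV::nat set). model_law X f \<theta>\<^sub>0).
           (\<forall>js. length js \<le> 6 \<longrightarrow>
              limsup (\<lambda>n. SUP \<theta>\<in>ball \<theta>\<^sub>0 \<epsilon>.
                ereal (\<bar>partial_derivs js (log_likelihood f n y) \<theta>\<bar> / real n)) < ereal K) \<and>
           liminf (\<lambda>n. INF \<theta>\<in>ball \<theta>\<^sub>0 \<epsilon>.
             ereal (det ((- 1 / real n) *\<^sub>R hessian (log_likelihood f n y) \<theta>))) > ereal \<eta> \<and>
           (\<forall>\<delta>>0. ball \<theta>\<^sub>0 \<delta> \<subseteq> \<Theta> \<longrightarrow>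
              limsup (\<lambda>n. SUP \<theta>\<in>\<Theta> - ball \<theta>\<^sub>0 \<delta>.
                ereal ((log_likelihood f n y \<theta> - log_likelihood f n y \<theta>\<^sub>0) / real n)) < 0)))"

subsection \<open>Bayes factors\<close>

definition marginal_likelihood ::
  "(real^'p::finite) set \<Rightarrow> ('y \<Rightarrow> real^'p \<Rightarrow> real) \<Rightarrow> (real^'p \<Rightarrow> real) \<Rightarrow>
     nat \<Rightarrow> (nat \<Rightarrow> 'y) \<Rightarrow> real" where
  "marginal_likelihood \<Theta> f prior n y = (LBINT \<theta>:\<Theta>. likelihood f n y \<theta> * prior \<theta>)"

definition bayes_factor ::
  "(real^'p::finite) set \<Rightarrow> ('y \<Rightarrow> real^'p \<Rightarrow> real) \<Rightarrow> (real^'p \<Rightarrow> real) \<Rightarrow> (real^'p \<Rightarrow> real) \<Rightarrow>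
     nat \<Rightarrow> (nat \<Rightarrow> 'y) \<Rightarrow> real" where
  "bayes_factor \<Theta> f prior\<^sub>1 prior\<^sub>0 n y =
     marginal_likelihood \<Theta> f prior\<^sub>1 n y / marginal_likelihood \<Theta> f prior\<^sub>0 n y"

text \<open>
  Only neighbourhoods of \<open>\<theta>\<close> are informative here: a prior on \<open>\<Theta>\<close> always gives mass 1 to \<open>\<Theta>\<close>.
\<close>

definition positive_mass_near ::
  "(real^'p::finite) set \<Rightarrow> (real^'p \<Rightarrow> real) \<Rightarrow> real^'p \<Rightarrow> bool" where
  "positive_mass_near \<Theta> prior \<theta> \<longleftrightarrow>
     (\<forall>U. open U \<longrightarrow> \<theta> \<in> U \<longrightarrow> emeasure (density_law \<Theta> prior) (U \<inter> \<Theta>) > 0)"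

subsection \<open>Sampling and convergence in probability\<close>

definition iid_sample :: "'w measure \<Rightarrow> 'y measure \<Rightarrow> (nat \<Rightarrow> 'w \<Rightarrow> 'y) \<Rightarrow> bool" where
  "iid_sample M P Y \<longleftrightarrow>
     prob_space.indep_vars M (\<lambda>_. P) Y UNIV \<and> (\<forall>i. distr M P (Y i) = P)"

text \<open>
  Measurability is part of the definition since \<^const>\<open>measure\<close> returns 0 on non-measurable sets.
\<close>

definition tendsto_in_prob ::
  "'w measure \<Rightarrow> (nat \<Rightarrow> 'w \<Rightarrow> real) \<Rightarrow> ('w \<Rightarrow> real) \<Rightarrow> bool" where
  "tendsto_in_prob M Z L \<longleftrightarrow>
     (\<forall>n. Z n \<in> borel_measurable M) \<and> L \<in> borel_measurable M \<and>
     (\<forall>\<epsilon>>0. (\<lambda>n. measure M {\<omega> \<in> space M. \<bar>Z n \<omega> - L \<omega>\<bar> > \<epsilon>}) \<longlonglongrightarrow> 0)"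

end

theory Submission
  imports Defs "HOL-Real_Asymp.Real_Asymp"
begin

text \<open>
  Both marginal likelihoods are compared with the same quantity: the integral \<open>A\<^sub>n\<close> of
  \<open>exp (\<ell>\<^sub>n t - \<ell>\<^sub>n \<theta>)\<close> over a fixed ball around \<open>\<theta>\<close>. Outside a ball of radius \<open>\<delta>\<close> the integrand
  is at most \<open>exp (- c n)\<close> by Laplace-regularity (iii), while the bound on the first derivatives
  gives \<open>\<bar>\<ell>\<^sub>n t - \<ell>\<^sub>n \<theta>\<bar> \<le> L n \<bar>t - \<theta>\<bar>\<close> and hence \<open>A\<^sub>n \<ge> v exp (- c n / 2)\<close>, where \<open>v\<close> is the
  volume of a ball so small that \<open>L r \<le> c / 2\<close>. So only an arbitrarily small neighbourhood of \<open>\<theta>\<close>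
  matters, and continuity of the prior \<open>p\<close> there shows that its marginal likelihood divided by
  \<open>exp (\<ell>\<^sub>n \<theta>) A\<^sub>n\<close> tends to \<open>p \<theta>\<close> almost surely. No second-order expansion is needed.
\<close>

section \<open>Lipschitz bounds from bounds on partial derivatives\<close>

text \<open>\<open>cont_diff_on\<close> only provides derivatives along coordinate axes, so the mean
  value inequality is applied to one coordinate at a time; each of the \<open>CARD('p)\<close> moves
  costs at most \<open>B * norm (t - a)\<close>.\<close>

lemma abs_diff_le_partial_derivs_bound:
  fixes F :: "real^'p::finite \<Rightarrow> real"
  assumes smooth: "cont_diff_on k F U" and k: "1 \<le> k" and ball: "ball a e \<subseteq> U"
    and bound: "\<And>j x. x \<in> ball a e \<Longrightarrow> \<bar>partial_derivs [j] F x\<bar> \<le> B"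
    and t: "t \<in> ball a e"
  shows "\<bar>F t - F a\<bar> \<le> B * CARD('p) * norm (t - a)"
proof -
  have a: "a \<in> ball a e" using t by (auto intro: le_less_trans[OF zero_le_dist])
  have B: "0 \<le> B" using bound[OF a] abs_ge_zero order_trans by blast
  have der: "((\<lambda>s. F (x + s *\<^sub>R axis j 1)) has_real_derivative partial_derivs [j] F (x + s *\<^sub>R axis j 1)) (at s)"
    if "x + s *\<^sub>R axis j 1 \<in> ball a e" for x j s
  proof -
    let ?y = "x + s *\<^sub>R axis j 1"
    have "\<forall>js. length js < k \<longrightarrow>
        (\<forall>j. \<forall>x\<in>U. (\<lambda>t. partial_derivs js F (x + t *\<^sub>R axis j 1)) differentiable (at 0))"
      using smooth by (simp add: cont_diff_on_def)
    from this[rule_format, of "[]" ?y j] have "(\<lambda>t. F (?y + t *\<^sub>R axis j 1)) differentiable (at 0)"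
      using that k ball by auto
    then have "((\<lambda>t. F (?y + t *\<^sub>R axis j 1)) has_real_derivative partial_derivs [j] F ?y) (at 0)"
      by (simp add: partial_deriv_def DERIV_deriv_iff_real_differentiable)
    then show ?thesis
      using DERIV_shift[of "\<lambda>s. F (x + s *\<^sub>R axis j 1)" "partial_derivs [j] F ?y" 0 s]
      by (simp add: algebra_simps)
  qed
  \<comment> \<open>Replacing coordinates of \<open>t\<close> by those of \<open>a\<close> one at a time never leaves the ball.\<close>
  have "\<bar>F t - F a\<bar> \<le> B * card S * norm (t - a)"
    if "finite S" "t \<in> ball a e" "\<And>i. i \<notin> S \<Longrightarrow> t $ i = a $ i" for S t
    using that
  proof (induction S arbitrary: t rule: finite_induct)
    case empty
    then have "t = a" by (simp add: vec_eq_iff)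
    then show ?case by simp
  next
    case (insert j S)
    define u where "u = (\<chi> i. if i = j then a $ i else t $ i)"
    have u_le: "norm (u - a) \<le> norm (t - a)"
      by (rule norm_le_componentwise_cart) (auto simp: u_def)
    have u: "u \<in> ball a e" using insert.prems(1) u_le by (simp add: dist_norm norm_minus_commute)
    have "\<bar>F u - F a\<bar> \<le> B * card S * norm (u - a)"
      by (rule insert.IH[OF u]) (use insert in \<open>auto simp: u_def\<close>)
    also have "\<dots> \<le> B * card S * norm (t - a)"
      using u_le B by (intro mult_left_mono) auto
    finally have 1: "\<bar>F u - F a\<bar> \<le> B * card S * norm (t - a)" .
    define d where "d = t $ j - a $ j"
    have tu: "t = u + d *\<^sub>R axis j 1"
      by (auto simp: vec_eq_iff u_def d_def axis_def)
    \<comment> \<open>The derivative bound is needed on the whole segment from \<open>u\<close> to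
      \<open>t\<close>; convexity keeps it in the ball.\<close>
    have in_ball: "u + s *\<^sub>R axis j 1 \<in> ball a e" if s: "s \<in> closed_segment 0 d" for s
    proof -
      obtain v where v: "0 \<le> v" "v \<le> 1" "s = v * d" using s by (auto simp: in_segment)
      have "u + s *\<^sub>R axis j 1 = (1 - v) *\<^sub>R u + v *\<^sub>R t"
        by (simp add: tu v algebra_simps)
      then show ?thesis
        using convexD_alt[OF convex_ball u insert.prems(1) v(1,2)] by simp
    qed
    have "norm (F (u + d *\<^sub>R axis j 1) - F (u + 0 *\<^sub>R axis j 1)) \<le> B * norm (d - 0)"
    proof (rule field_differentiable_bound[OF convex_closed_segment[of 0 d]])
      fix s assume "s \<in> closed_segment 0 d"
      then show "((\<lambda>s. F (u + s *\<^sub>R axis j 1)) has_real_derivative partial_derivs [j] F (u + s *\<^sub>R axis j 1))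
           (at s within closed_segment 0 d)"
        using der in_ball has_field_derivative_at_within by blast
      show "norm (partial_derivs [j] F (u + s *\<^sub>R axis j 1)) \<le> B"
        unfolding real_norm_def by (rule bound[OF in_ball]) fact
    qed auto
    then have "\<bar>F t - F u\<bar> \<le> B * \<bar>d\<bar>" by (simp add: tu)
    also have "\<dots> \<le> B * norm (t - a)"
      using component_le_norm_cart[of "t - a" j] B by (intro mult_left_mono) (auto simp: d_def)
    finally have "\<bar>F t - F u\<bar> \<le> B * norm (t - a)" .
    with 1 show ?case using insert.hyps by (simp add: algebra_simps)
  qed
  from this[of UNIV t] t show ?thesis by simp
qed

section \<open>Joint measurability in data and parameter\<close>

text \<open>
  The argument \<open>t\<close> is approximated by simple functions \<open>q i t\<close>; their values may lie outside \<open>S\<close>,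
  but since \<open>S\<close> is open only finitely many do for a given \<open>t \<in> S\<close>.
\<close>
lemma borel_measurable_caratheodory:
  fixes F :: "'a \<Rightarrow> 'b::euclidean_space \<Rightarrow> real"
  assumes "open S" and meas: "\<And>t. t \<in> S \<Longrightarrow> (\<lambda>\<omega>. F \<omega> t) \<in> borel_measurable M"
    and cont: "\<And>\<omega>. \<omega> \<in> space M \<Longrightarrow> continuous_on S (F \<omega>)"
  shows "(\<lambda>(\<omega>, t). indicator S t * F \<omega> t) \<in> borel_measurable (M \<Otimes>\<^sub>M borel)"
proof -
  have "(\<lambda>t::'b. t) \<in> borel_measurable borel" by simp
  from borel_measurable_implies_sequence_metric[OF this, of 0] obtain q :: "nat \<Rightarrow> 'b \<Rightarrow> 'b"
    where q: "\<And>i. simple_function borel (q i)" and lim: "\<And>t. (\<lambda>i. q i t) \<longlonglongrightarrow> t"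
    by auto
  define G where "G s \<omega> = (indicator S s * F \<omega> s :: real)" for s \<omega>
  have G: "(\<lambda>z. G s (fst z)) \<in> borel_measurable (M \<Otimes>\<^sub>M (borel :: 'b measure))" for s
    by (cases "s \<in> S") (auto simp: G_def intro!: measurable_compose[OF measurable_fst meas])
  \<comment> \<open>Since \<open>q i\<close> has finite range, this function is glued from finitely
    many functions \<open>G s\<close>, each measurable.\<close>
  have approx: "(\<lambda>z. G (q i (snd z)) (fst z)) \<in> borel_measurable (M \<Otimes>\<^sub>M borel)" for i
  proof (rule measurable_compose_countable'[where I = "range (q i)", OF G])
    show "countable (range (q i))"
      using simple_functionD(1)[OF q] by (simp add: countable_finite)
    have "q i \<in> measurable borel (count_space (range (q i)))"
      using q[of i] by (simp add: simple_function_def measurable_count_space_eq2)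
    then show "(\<lambda>z. q i (snd z)) \<in> measurable (M \<Otimes>\<^sub>M borel) (count_space (range (q i)))"
      by (rule measurable_compose[OF measurable_snd])
  qed
  \<comment> \<open>The outer indicator handles \<open>t\<close> outside \<open>S\<close>: there
    \<open>q i t\<close> may still fall into \<open>S\<close>, and \<open>G (q i t)\<close> need not
    converge.\<close>
  have "(\<lambda>z. indicator S (snd z) * G (q i (snd z)) (fst z)) \<in> borel_measurable (M \<Otimes>\<^sub>M borel)" for i
    using \<open>open S\<close>
    by (intro borel_measurable_times approx measurable_compose[OF measurable_snd borel_measurable_indicator]) auto
  then show ?thesis
  proof (rule borel_measurable_LIMSEQ_real[rotated])
    fix z assume "z \<in> space (M \<Otimes>\<^sub>M (borel :: 'b measure))"
    then obtain \<omega> t where z: "z = (\<omega>, t)" and \<omega>: "\<omega> \<in> space M"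
      by (auto simp: space_pair_measure)
    have "(\<lambda>i. G (q i t) \<omega>) \<longlonglongrightarrow> F \<omega> t" if t: "t \<in> S"
    proof -
      have "isCont (F \<omega>) t" using cont[OF \<omega>] \<open>open S\<close> t by (simp add: continuous_on_eq_continuous_at)
      then have "(\<lambda>i. F \<omega> (q i t)) \<longlonglongrightarrow> F \<omega> t" using lim[of t] by (rule isCont_tendsto_compose)
      moreover have "eventually (\<lambda>i. q i t \<in> S) sequentially"
        using topological_tendstoD[OF lim \<open>open S\<close> t] .
      then have "eventually (\<lambda>i. F \<omega> (q i t) = G (q i t) \<omega>) sequentially"
        by eventually_elim (simp add: G_def)
      ultimately show ?thesis by (rule Lim_transform_eventually)
    qed
    then show "(\<lambda>i. indicator S (snd z) * G (q i (snd z)) (fst z)) \<longlonglongrightarrow> (case z of (\<omega>, t) \<Rightarrow> indicator S t * F \<omega> t)"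
      by (cases "t \<in> S") (auto simp: z)
  qed
qed

section \<open>From almost sure convergence to convergence in probability\<close>

text \<open>Dominated convergence for the indicators of the deviation events; the majorant 1 is
  integrable because \<open>M\<close> is a probability space.\<close>

lemma tendsto_in_prob_of_AE:
  assumes "prob_space M" and Z[measurable]: "\<And>n. Z n \<in> borel_measurable M"
    and L[measurable]: "L \<in> borel_measurable M"
    and lim: "AE \<omega> in M. (\<lambda>n. Z n \<omega>) \<longlonglongrightarrow> L \<omega>"
  shows "tendsto_in_prob M Z L"
  unfolding tendsto_in_prob_def
proof (intro conjI allI impI)
  interpret prob_space M by fact
  fix \<epsilon> :: real assume \<epsilon>: "\<epsilon> > 0"
  let ?A = "\<lambda>n. {\<omega> \<in> space M. \<epsilon> < \<bar>Z n \<omega> - L \<omega>\<bar>}"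
  have "(\<lambda>n. \<integral>\<omega>. indicator (?A n) \<omega> \<partial>M) \<longlonglongrightarrow> (\<integral>\<omega>. 0 \<partial>M :: real)"
  proof (rule integral_dominated_convergence[where w = "\<lambda>_. 1"])
    show "AE \<omega> in M. (\<lambda>n. indicator (?A n) \<omega>) \<longlonglongrightarrow> (0::real)"
      using lim
    proof eventually_elim
      case (elim \<omega>)
      then have "eventually (\<lambda>n. dist (Z n \<omega>) (L \<omega>) < \<epsilon>) sequentially"
        using \<epsilon> by (rule tendstoD)
      then have "eventually (\<lambda>n. indicator (?A n) \<omega> = (0::real)) sequentially"
        by eventually_elim (auto simp: dist_real_def)
      then show ?case by (rule tendsto_eventually)
    qed
  qed auto
  then show "(\<lambda>n. measure M (?A n)) \<longlonglongrightarrow> 0" by simp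
qed (use assms in auto)

section \<open>Concentration of the integrals near the true parameter\<close>

text \<open>This is the deterministic core, meant for one fixed data sequence with
  \<open>h n t\<close> the log-likelihood ratio of \<open>t\<close> against \<open>\<theta>\<close>.
  The denominator does not involve \<open>p\<close>, so it cancels when two priors are
  compared.\<close>

lemma laplace_concentration:
  fixes h :: "nat \<Rightarrow> 'a::euclidean_space \<Rightarrow> real" and p :: "'a \<Rightarrow> real" and L :: real
  assumes \<Theta>: "open \<Theta>" and e: "0 < e" "ball \<theta> e \<subseteq> \<Theta>" and L: "0 \<le> L"
    and cont: "\<And>n. continuous_on \<Theta> (h n)"
    and lip: "\<forall>\<^sub>F n in sequentially. \<forall>t\<in>ball \<theta> e. \<bar>h n t\<bar> \<le> L * n * norm (t - \<theta>)"
    and sep: "\<And>\<delta>. 0 < \<delta> \<Longrightarrow> ball \<theta> \<delta> \<subseteq> \<Theta> \<Longrightarrow>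
       \<exists>c>0. \<forall>\<^sub>F n in sequentially. \<forall>t\<in>\<Theta> - ball \<theta> \<delta>. h n t \<le> - c * real n"
    and p: "set_integrable lborel \<Theta> p" and p_cont: "isCont p \<theta>"
  shows "(\<lambda>n. (LBINT t:\<Theta>. exp (h n t) * p t) / (LBINT t:ball \<theta> e. exp (h n t))) \<longlonglongrightarrow> p \<theta>"
proof (rule tendstoI)
  fix \<epsilon> :: real assume \<epsilon>: "0 < \<epsilon>"
  define P where "P n t = indicator \<Theta> t * (exp (h n t) * p t)" for n t
  define G where "G n t = indicator (ball \<theta> e) t * exp (h n t)" for n t
  define A where "A n = (LBINT t. G n t)" for n
  \<comment> \<open>On \<Theta> the sum of \<open>\<bar>P n t\<bar>\<close> and
    \<open>\<bar>p \<theta> * G n t\<bar>\<close> is exactly \<open>exp (h n t) * W t\<close>, so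
    \<open>W\<close> is an integrable weight for the region away from \<theta>.\<close>
  define W where "W t = indicator \<Theta> t * \<bar>p t\<bar> + \<bar>p \<theta>\<bar> * indicator (ball \<theta> e) t" for t
  obtain d0 where d0: "0 < d0" "\<And>t. dist t \<theta> < d0 \<Longrightarrow> \<bar>p t - p \<theta>\<bar> < \<epsilon> / 2"
    using p_cont \<epsilon> unfolding continuous_at_eps_delta dist_real_def
    by (metis half_gt_zero)
  define d where "d = min d0 e"
  have d: "0 < d" "ball \<theta> d \<subseteq> ball \<theta> e" "\<And>t. t \<in> ball \<theta> d \<Longrightarrow> \<bar>p t - p \<theta>\<bar> \<le> \<epsilon> / 2"
    using d0 e by (auto simp: d_def dist_commute intro: less_imp_le)
  obtain c where c: "0 < c"
    and sep_c: "\<forall>\<^sub>F n in sequentially. \<forall>t\<in>\<Theta> - ball \<theta> d. h n t \<le> - c * real n"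
    using sep[OF d(1)] d(2) e(2) by blast
  \<comment> \<open>The second entry makes \<open>L * r\<close> at most \<open>c / 2\<close>;
    dividing by \<open>L + 1\<close> covers \<open>L = 0\<close>. The minimum with \<open>e\<close>
    stays within reach of the Lipschitz bound.\<close>
  define r where "r = min e (c / (2 * (L + 1)))"
  have r: "0 < r" "r \<le> e" "L * r \<le> c / 2"
  proof -
    show "0 < r" "r \<le> e" using e c L by (auto simp: r_def)
    have "L * r \<le> L * (c / (2 * (L + 1)))" using L by (intro mult_left_mono) (auto simp: r_def)
    also have "\<dots> \<le> c / 2" using c L by (simp add: field_simps)
    finally show "L * r \<le> c / 2" .
  qed
  define v where "v = measure lborel (ball \<theta> r)"
  have v: "0 < v" unfolding v_def using r content_ball_pos by (metis measure_completion lborel_def)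
  define C where "C = (LBINT t. W t)"
  have pm[measurable]: "(\<lambda>t. indicator \<Theta> t * p t) \<in> borel_measurable borel"
    using p by (auto simp: set_integrable_def dest: borel_measurable_integrable)
  have exp_m[measurable]: "(\<lambda>t. indicator \<Theta> t * exp (h n t)) \<in> borel_measurable borel" for n
    using borel_measurable_continuous_on_indicator[OF _ continuous_on_exp[OF cont[of n]]] \<Theta> by simp
  have Pm[measurable]: "P n \<in> borel_measurable borel" for n
  proof -
    have "P n = (\<lambda>t. (indicator \<Theta> t * exp (h n t)) * (indicator \<Theta> t * p t))"
      by (auto simp: P_def fun_eq_iff indicator_def)
    then show ?thesis by simp
  qed
  have Gm[measurable]: "G n \<in> borel_measurable borel" for n
  proof -
    have "G n = (\<lambda>t. indicator (ball \<theta> e) t * (indicator \<Theta> t * exp (h n t)))"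
      using e by (auto simp: G_def fun_eq_iff indicator_def)
    also have "\<dots> \<in> borel_measurable borel"
      by (intro borel_measurable_times exp_m borel_measurable_indicator) simp
    finally show ?thesis .
  qed
  have ball_int: "integrable lborel (indicator (ball \<theta> s) :: 'a \<Rightarrow> real)" for s
    using emeasure_lborel_ball_finite by (intro integrable_real_indicator) auto
  have W: "integrable lborel W"
  proof -
    have "integrable lborel (\<lambda>t. \<bar>indicator \<Theta> t * p t\<bar>)"
      using p by (intro integrable_abs) (simp add: set_integrable_def)
    then have "integrable lborel (\<lambda>t. indicator \<Theta> t * \<bar>p t\<bar>)" by (simp add: abs_mult)
    then show ?thesis unfolding W_def using ball_int by simp
  qed
  have C: "0 \<le> C" unfolding C_def by (rule integral_nonneg_AE) (auto simp: W_def)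
  \<comment> \<open>This is the ratio of the bound \<open>exp (- c * n) * C\<close> for the far part
    to the lower bound \<open>exp (- (c / 2) * n) * v\<close> for \<open>A n\<close>.\<close>
  have "(\<lambda>n. C / v * exp (- (c / 2) * real n)) \<longlonglongrightarrow> 0"
    using c by real_asymp
  then have small: "\<forall>\<^sub>F n in sequentially. C / v * exp (- (c / 2) * real n) < \<epsilon> / 2"
    using \<epsilon> by (intro order_tendstoD(2)[where a = "\<epsilon> / 2"]) auto
  show "\<forall>\<^sub>F n in sequentially. dist ((LBINT t:\<Theta>. exp (h n t) * p t) / (LBINT t:ball \<theta> e. exp (h n t))) (p \<theta>) < \<epsilon>"
    using lip sep_c small
  proof eventually_elim
    case (elim n)
    \<comment> \<open>The first term pays for \<open>ball \<theta> d\<close>, where \<open>p\<close>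
      is nearly constant, the second for the rest of \<Theta>; outside \<Theta> everything vanishes.
      Integrating this bound gives \<open>up\<close>.\<close>
    have bnd: "\<bar>P n t - p \<theta> * G n t\<bar> \<le> \<epsilon> / 2 * G n t + exp (- c * n) * W t" for t
    proof -
      consider "t \<in> ball \<theta> d" | "t \<in> \<Theta> - ball \<theta> d" | "t \<notin> \<Theta>" "t \<notin> ball \<theta> e"
        using e by blast
      then show ?thesis
      proof cases
        case 1
        then have "t \<in> ball \<theta> e" "t \<in> \<Theta>" using d e by auto
        then have "P n t - p \<theta> * G n t = exp (h n t) * (p t - p \<theta>)"
          by (simp add: P_def G_def algebra_simps)
        then have "\<bar>P n t - p \<theta> * G n t\<bar> = exp (h n t) * \<bar>p t - p \<theta>\<bar>"
          by (simp add: abs_mult)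
        also have "\<dots> \<le> exp (h n t) * (\<epsilon> / 2)" using d(3)[OF 1] by simp
        also have "\<dots> = \<epsilon> / 2 * G n t" using \<open>t \<in> ball \<theta> e\<close> by (simp add: G_def)
        finally show ?thesis by (simp add: W_def add_increasing2)
      next
        case 2
        then have le: "exp (h n t) \<le> exp (- c * n)" using elim(2) by auto
        have "\<bar>P n t - p \<theta> * G n t\<bar> \<le> \<bar>P n t\<bar> + \<bar>p \<theta> * G n t\<bar>" by (rule abs_triangle_ineq4)
        also have "\<dots> = exp (h n t) * W t"
          using 2 by (simp add: P_def G_def W_def abs_mult algebra_simps)
        also have "\<dots> \<le> exp (- c * n) * W t"
          using le by (intro mult_right_mono) (auto simp: W_def)
        finally show ?thesis using \<epsilon> by (simp add: G_def add_increasing)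
      next
        case 3
        then show ?thesis by (simp add: P_def G_def W_def)
      qed
    qed
    \<comment> \<open>Continuity of \<open>h n\<close> on the open ball gives no bound; the
      Lipschitz estimate does, for the large \<open>n\<close> considered here.\<close>
    have Gi: "integrable lborel (G n)"
    proof (rule Bochner_Integration.integrable_bound)
      show "integrable lborel (\<lambda>t. exp (L * n * e) * indicator (ball \<theta> e) t :: real)"
        using ball_int by simp
      show "AE t in lborel. norm (G n t) \<le> norm (exp (L * n * e) * indicator (ball \<theta> e) t :: real)"
      proof (rule AE_I2)
        fix t
        show "norm (G n t) \<le> norm (exp (L * n * e) * indicator (ball \<theta> e) t :: real)"
        proof (cases "t \<in> ball \<theta> e")
          case True
          then have "norm (t - \<theta>) \<le> e" by (simp add: dist_norm norm_minus_commute)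
          then have "L * n * norm (t - \<theta>) \<le> L * n * e" using L by (intro mult_left_mono) auto
          moreover have "\<bar>h n t\<bar> \<le> L * n * norm (t - \<theta>)" using elim(1) True by blast
          ultimately show ?thesis using True by (simp add: G_def)
        qed (simp add: G_def)
      qed
    qed simp
    have Bi: "integrable lborel (\<lambda>t. \<epsilon> / 2 * G n t + exp (- c * n) * W t)" using Gi W by simp
    have Di: "integrable lborel (\<lambda>t. P n t - p \<theta> * G n t)"
      by (rule Bochner_Integration.integrable_bound[OF Bi])
         (use bnd in \<open>auto intro!: AE_I2 intro: order_trans[OF _ abs_ge_self]\<close>)
    \<comment> \<open>Integrability of \<open>P n\<close> is not assumed: it is recovered from the
      dominated difference and \<open>G n\<close>.\<close>
    have "integrable lborel (\<lambda>t. (P n t - p \<theta> * G n t) + p \<theta> * G n t)"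
      using Di Gi by (intro Bochner_Integration.integrable_add) auto
    then have Pi: "integrable lborel (P n)" by simp
    have up: "\<bar>(LBINT t. P n t) - p \<theta> * A n\<bar> \<le> \<epsilon> / 2 * A n + exp (- c * n) * C"
    proof -
      have "\<bar>LBINT t. P n t - p \<theta> * G n t\<bar> \<le> (LBINT t. \<epsilon> / 2 * G n t + exp (- c * n) * W t)"
        by (rule integral_abs_bound_integral[OF Di Bi]) (rule bnd)
      then show ?thesis using Pi Gi W by (simp add: A_def C_def)
    qed
    have low: "exp (- (c / 2) * n) * v \<le> A n"
    proof -
      have "(LBINT t. exp (- (c / 2) * n) * indicator (ball \<theta> r) t) \<le> A n"
        unfolding A_def
      proof (rule integral_mono)
        fix t
        show "exp (- (c / 2) * n) * indicator (ball \<theta> r) t \<le> G n t"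
        proof (cases "t \<in> ball \<theta> r")
          case True
          then have t: "norm (t - \<theta>) \<le> r" "t \<in> ball \<theta> e"
            using r by (auto simp: dist_norm norm_minus_commute)
          have "L * n * norm (t - \<theta>) \<le> n * (L * r)" using L t(1)
            by (simp add: mult.assoc mult.left_commute mult_left_mono)
          also have "\<dots> \<le> n * (c / 2)" using r(3) by (intro mult_left_mono) auto
          finally have "\<bar>h n t\<bar> \<le> n * (c / 2)" using elim(1) t(2) by fastforce
          then show ?thesis using True t(2) by (simp add: G_def algebra_simps)
        qed (simp add: G_def)
      qed (use ball_int Gi in auto)
      then show ?thesis by (simp add: v_def)
    qed
    have A: "0 < A n" using low v by (smt (verit) exp_gt_zero mult_pos_pos)
    \<comment> \<open>Splitting \<open>exp (- c * n)\<close> into two equal factors, one is absorbed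
      with \<open>v\<close> into \<open>A n\<close> and the other makes the remainder small.\<close>
    have "exp (- c * n) * C = exp (- (c / 2) * n) * v * (C / v * exp (- (c / 2) * n))"
      using v by (simp flip: exp_add)
    also have "\<dots> \<le> A n * (C / v * exp (- (c / 2) * n))"
      using low C v by (intro mult_right_mono) auto
    also have "\<dots> < A n * (\<epsilon> / 2)" using A elim(3) by (intro mult_strict_left_mono) auto
    finally have "exp (- c * n) * C < A n * (\<epsilon> / 2)" .
    with up have "\<bar>(LBINT t. P n t) - p \<theta> * A n\<bar> < \<epsilon> * A n" by (simp add: mult.commute)
    then have "\<bar>(LBINT t. P n t) / A n - p \<theta>\<bar> < \<epsilon>"
      using A by (simp add: field_simps abs_less_iff)
    then show ?case by (simp add: dist_real_def P_def[abs_def] A_def G_def[abs_def] set_lebesgue_integral_def)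
  qed
qed

section \<open>Smoothness, densities, i.i.d. samples and uniform bounds\<close>

lemma continuous_on_if_cont_diff_on: "cont_diff_on k F U \<Longrightarrow> continuous_on U F"
  by (auto simp: cont_diff_on_def dest: spec[of _ "[]"])

lemma isCont_if_cont_diff_at: "cont_diff_at k F x \<Longrightarrow> isCont F x"
  by (auto simp: cont_diff_at_def continuous_on_eq_continuous_at dest: continuous_on_if_cont_diff_on)

lemma set_integrable_if_prob_density_on:
  assumes "prob_density_on S g"
  shows "set_integrable lborel S g"
proof -
  have S: "S \<in> sets borel" using assms by (simp add: prob_density_on_def)
  have "integrable (restrict_space lborel S) g"
  proof (rule integrableI_nonneg)
    show "AE x in restrict_space lborel S. 0 \<le> g x"
      using assms by (intro AE_I2) (auto simp: prob_density_on_def space_restrict_space)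
  qed (use assms in \<open>auto simp: prob_density_on_def\<close>)
  then show ?thesis
    using S by (simp add: set_integrable_def integrable_restrict_space)
qed

text \<open>Laplace-regularity speaks of the product measure on sequences, while the data live on
  \<open>M\<close>; independence identifies the joint law of \<open>Y\<close> with that
  product.\<close>

lemma AE_iid_sample:
  assumes "prob_space M" and iid: "iid_sample M P Y" and P: "AE y in (\<Pi>\<^sub>M i\<in>UNIV. P). Q y"
  shows "AE \<omega> in M. Q (\<lambda>i. Y i \<omega>)"
proof -
  interpret prob_space M by fact
  have indep: "indep_vars (\<lambda>_. P) Y UNIV" and law: "\<And>i. distr M P (Y i) = P"
    using iid by (auto simp: iid_sample_def)
  have Y[measurable]: "Y i \<in> M \<rightarrow>\<^sub>M P" for i using indep by (auto simp: indep_vars_def)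
  have "distr M (\<Pi>\<^sub>M i\<in>UNIV. P) (\<lambda>\<omega>. \<lambda>i\<in>UNIV. Y i \<omega>) = (\<Pi>\<^sub>M i\<in>UNIV. P)"
    using indep indep_vars_iff_distr_eq_PiM[of UNIV Y "\<lambda>_. P"] Y law by auto
  then have law_Y: "distr M (\<Pi>\<^sub>M i\<in>UNIV. P) (\<lambda>\<omega> i. Y i \<omega>) = (\<Pi>\<^sub>M i\<in>UNIV. P)"
    by (simp add: restrict_UNIV)
  have "AE y in distr M (\<Pi>\<^sub>M i\<in>UNIV. P) (\<lambda>\<omega> i. Y i \<omega>). Q y"
    unfolding law_Y by (rule P)
  then show ?thesis
    by (rule AE_distrD[rotated]) (auto intro!: measurable_PiM_single' intro: measurable_space[OF Y])
qed

text \<open>Eventually the supremum itself lies below \<open>c\<close>, which yields one threshold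
  for \<open>n\<close> that serves all \<open>t\<close>.\<close>

lemma eventually_less_if_limsup_SUP_less:
  assumes "limsup (\<lambda>n. SUP t\<in>T. ereal (g n t)) < ereal c"
  shows "\<forall>\<^sub>F n in sequentially. \<forall>t\<in>T. g n t < c"
  using Limsup_lessD[OF assms]
proof eventually_elim
  case (elim n)
  then show ?case by (metis SUP_upper ereal_less(1) le_less_trans less_ereal.simps(1))
qed

lemma likelihood_eq_exp:
  assumes "\<And>i. 0 < f (y i) t"
  shows "likelihood f n y t = exp (log_likelihood f n y t)"
  using assms by (simp add: likelihood_def log_likelihood_def exp_sum)

section \<open>Convergence of the Bayes factor\<close>

theorem theorem1:
  fixes X :: "'y::euclidean_space set"
    and \<Theta> :: "(real^'p::finite) set"
    and f :: "'y \<Rightarrow> real^'p \<Rightarrow> real"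
    and prior\<^sub>0 prior\<^sub>1 :: "real^'p \<Rightarrow> real"
    and M :: "'w measure"
    and Y :: "nat \<Rightarrow> 'w \<Rightarrow> 'y"
    and \<theta> :: "real^'p"
  assumes "open \<Theta>" and "interior \<Theta> \<noteq> {}"
    and "\<And>t. t \<in> \<Theta> \<Longrightarrow> prob_density_on X (\<lambda>y. f y t)"
    and "identifiable X \<Theta> f"
    and "laplace_regular X \<Theta> f"
    and "\<theta> \<in> \<Theta>"
    and "prob_space M"
    and "iid_sample M (model_law X f \<theta>) Y"
    and "prob_density_on \<Theta> prior\<^sub>0" and "prob_density_on \<Theta> prior\<^sub>1"
    and "positive_mass_near \<Theta> prior\<^sub>0 \<theta>" and "positive_mass_near \<Theta> prior\<^sub>1 \<theta>"
    and "prior\<^sub>0 \<theta> \<noteq> 0"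
    and "cont_diff_at 4 prior\<^sub>0 \<theta>" and "cont_diff_at 4 prior\<^sub>1 \<theta>"
  shows "tendsto_in_prob M (\<lambda>n \<omega>. bayes_factor \<Theta> f prior\<^sub>1 prior\<^sub>0 n (\<lambda>i. Y i \<omega>))
           (\<lambda>_. prior\<^sub>1 \<theta> / prior\<^sub>0 \<theta>)"
proof (rule tendsto_in_prob_of_AE)
  interpret prob_space M by fact
  have pos: "0 < f y t" if "y \<in> X" "t \<in> \<Theta>" for y t
    using assms(5) that by (auto simp: laplace_regular_def)
  have smooth: "cont_diff_on 6 (log_likelihood f n y) \<Theta>" if "\<And>i. y i \<in> X" for n y
    using assms(5) that by (auto simp: laplace_regular_def)
  have [measurable]: "Y i \<in> M \<rightarrow>\<^sub>M model_law X f \<theta>" for i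
    using assms(8) by (auto simp: iid_sample_def indep_vars_def)
  then have Y: "Y i \<in> M \<rightarrow>\<^sub>M restrict_space lborel X" for i
    by (simp add: model_law_def density_law_def cong: measurable_cong_sets)
  have X: "Y i \<omega> \<in> X" if "\<omega> \<in> space M" for i \<omega>
    using measurable_space[OF Y that] by (simp add: space_restrict_space)
  have lik: "likelihood f n (\<lambda>i. Y i \<omega>) t = exp (log_likelihood f n (\<lambda>i. Y i \<omega>) t)"
    if "\<omega> \<in> space M" "t \<in> \<Theta>" for n \<omega> t
    using that X pos by (intro likelihood_eq_exp) auto
  have cont: "continuous_on \<Theta> (log_likelihood f n (\<lambda>i. Y i \<omega>))" if "\<omega> \<in> space M" for n \<omega>
    by (rule continuous_on_if_cont_diff_on[OF smooth]) (rule X[OF that])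
  \<comment> \<open>The likelihood is measurable in the data for fixed \<open>t\<close> and
    continuous in \<open>t\<close>, hence jointly measurable; integrating out \<open>t\<close>
    preserves measurability.\<close>
  have marginal_meas: "(\<lambda>\<omega>. marginal_likelihood \<Theta> f p n (\<lambda>i. Y i \<omega>)) \<in> borel_measurable M"
    if "prob_density_on \<Theta> p" for p n
  proof -
    have [measurable]: "(\<lambda>(\<omega>, t). indicator \<Theta> t * likelihood f n (\<lambda>i. Y i \<omega>) t)
        \<in> borel_measurable (M \<Otimes>\<^sub>M borel)"
    proof (rule borel_measurable_caratheodory[OF assms(1)])
      fix t assume "t \<in> \<Theta>"
      then have "(\<lambda>y. f y t) \<in> borel_measurable (restrict_space lborel X)"
        using assms(3) by (simp add: prob_density_on_def)
      then show "(\<lambda>\<omega>. likelihood f n (\<lambda>i. Y i \<omega>) t) \<in> borel_measurable M"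
        unfolding likelihood_def
        by (intro borel_measurable_prod) (rule measurable_compose[OF Y])
    next
      fix \<omega> assume \<omega>: "\<omega> \<in> space M"
      have "continuous_on \<Theta> (\<lambda>t. exp (log_likelihood f n (\<lambda>i. Y i \<omega>) t))"
        by (intro continuous_intros cont \<omega>)
      then show "continuous_on \<Theta> (likelihood f n (\<lambda>i. Y i \<omega>))"
        using lik[OF \<omega>] by (simp cong: continuous_on_cong)
    qed
    have [measurable]: "(\<lambda>t. indicator \<Theta> t * p t) \<in> borel_measurable borel"
      using set_integrable_if_prob_density_on[OF that]
      by (auto simp: set_integrable_def dest: borel_measurable_integrable)
    \<comment> \<open>Each factor carries its own indicator, because likelihood and prior are only
      controlled on \<Theta>.\<close>
    have "(\<lambda>z. (case z of (\<omega>, t) \<Rightarrow> indicator \<Theta> t * likelihood f n (\<lambda>i. Y i \<omega>) t) * (indicator \<Theta> (snd z) * p (snd z)))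
        \<in> borel_measurable (M \<Otimes>\<^sub>M lborel)"
      by measurable
    also have "(\<lambda>z. (case z of (\<omega>, t) \<Rightarrow> indicator \<Theta> t * likelihood f n (\<lambda>i. Y i \<omega>) t) * (indicator \<Theta> (snd z) * p (snd z)))
       = (\<lambda>(\<omega>, t). indicator \<Theta> t *\<^sub>R (likelihood f n (\<lambda>i. Y i \<omega>) t * p t))"
      by (auto simp: fun_eq_iff indicator_def)
    finally show ?thesis
      unfolding marginal_likelihood_def set_lebesgue_integral_def
      by (rule lborel.borel_measurable_lebesgue_integral)
  qed
  show "(\<lambda>\<omega>. bayes_factor \<Theta> f prior\<^sub>1 prior\<^sub>0 n (\<lambda>i. Y i \<omega>)) \<in> borel_measurable M" for n
    unfolding bayes_factor_def using marginal_meas assms(9,10) by (intro borel_measurable_divide) auto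
  obtain e K where e: "0 < e" "ball \<theta> e \<subseteq> \<Theta>" and K: "0 < K"
    and reg: "AE y in (\<Pi>\<^sub>M i\<in>(UNIV::nat set). model_law X f \<theta>).
        (\<forall>js. length js \<le> 6 \<longrightarrow> limsup (\<lambda>n. SUP t\<in>ball \<theta> e.
            ereal (\<bar>partial_derivs js (log_likelihood f n y) t\<bar> / real n)) < ereal K) \<and>
        (\<forall>\<delta>>0. ball \<theta> \<delta> \<subseteq> \<Theta> \<longrightarrow> limsup (\<lambda>n. SUP t\<in>\<Theta> - ball \<theta> \<delta>.
            ereal ((log_likelihood f n y t - log_likelihood f n y \<theta>) / real n)) < 0)"
  proof -
    obtain e K \<eta> where *: "0 < e" "ball \<theta> e \<subseteq> \<Theta>" "0 < K"
      "AE y in (\<Pi>\<^sub>M i\<in>(UNIV::nat set). model_law X f \<theta>).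
           (\<forall>js. length js \<le> 6 \<longrightarrow>
              limsup (\<lambda>n. SUP t\<in>ball \<theta> e.
                ereal (\<bar>partial_derivs js (log_likelihood f n y) t\<bar> / real n)) < ereal K) \<and>
           liminf (\<lambda>n. INF t\<in>ball \<theta> e.
             ereal (det ((- 1 / real n) *\<^sub>R hessian (log_likelihood f n y) t))) > ereal \<eta> \<and>
           (\<forall>\<delta>>0. ball \<theta> \<delta> \<subseteq> \<Theta> \<longrightarrow>
              limsup (\<lambda>n. SUP t\<in>\<Theta> - ball \<theta> \<delta>.
                ereal ((log_likelihood f n y t - log_likelihood f n y \<theta>) / real n)) < 0)"
      using assms(5,6) unfolding laplace_regular_def by meson
    show thesis by (rule that[OF *(1-3)]) (use *(4) in eventually_elim, blast)
  qed
  show "AE \<omega> in M. (\<lambda>n. bayes_factor \<Theta> f prior\<^sub>1 prior\<^sub>0 n (\<lambda>i. Y i \<omega>)) \<longlonglongrightarrow> prior\<^sub>1 \<theta> / prior\<^sub>0 \<theta>"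
    using AE_iid_sample[OF assms(7,8) reg] AE_space
  proof eventually_elim
    case (elim \<omega>)
    \<comment> \<open>With \<open>\<omega>\<close> fixed, the remaining argument is
      deterministic.\<close>
    define l where "l n = log_likelihood f n (\<lambda>i. Y i \<omega>)" for n
    define h where "h n t = l n t - l n \<theta>" for n t
    define A where "A n = (LBINT t:ball \<theta> e. exp (h n t))" for n
    have deriv_bound: "limsup (\<lambda>n. SUP t\<in>ball \<theta> e. ereal (\<bar>partial_derivs [j] (l n) t\<bar> / real n)) < ereal K" for j
      using elim(1) unfolding l_def by (auto dest: spec[of _ "[j]"])
    \<comment> \<open>There are finitely many coordinates \<open>j\<close>, so one threshold for
      \<open>n\<close> serves all of them.\<close>
    have "\<forall>\<^sub>F n in sequentially. \<forall>j. \<forall>t\<in>ball \<theta> e. \<bar>partial_derivs [j] (l n) t\<bar> / real n < K"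
      using eventually_less_if_limsup_SUP_less[OF deriv_bound] by (intro eventually_all_finite) auto
    then have lip: "\<forall>\<^sub>F n in sequentially. \<forall>t\<in>ball \<theta> e. \<bar>h n t\<bar> \<le> (K * CARD('p)) * n * norm (t - \<theta>)"
      using eventually_gt_at_top[of 0]
    proof eventually_elim
      case (elim n)
      show ?case
      proof
        fix t assume t: "t \<in> ball \<theta> e"
        have "cont_diff_on 6 (l n) \<Theta>" 
          unfolding l_def by (rule smooth) (rule X[OF \<open>\<omega> \<in> space M\<close>])
        moreover have "\<bar>partial_derivs [j] (l n) x\<bar> \<le> K * n" if "x \<in> ball \<theta> e" for j x
          using elim that by (simp add: pos_divide_less_eq less_imp_le)
        ultimately have "\<bar>l n t - l n \<theta>\<bar> \<le> (K * n) * CARD('p) * norm (t - \<theta>)"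
          using e(2) t by (intro abs_diff_le_partial_derivs_bound[where k = 6]) auto
        then show "\<bar>h n t\<bar> \<le> (K * CARD('p)) * n * norm (t - \<theta>)" by (simp add: h_def algebra_simps)
      qed
    qed
    have sep: "\<exists>c>0. \<forall>\<^sub>F n in sequentially. \<forall>t\<in>\<Theta> - ball \<theta> \<delta>. h n t \<le> - c * real n"
      if \<delta>: "0 < \<delta>" "ball \<theta> \<delta> \<subseteq> \<Theta>" for \<delta>
    proof -
      have "limsup (\<lambda>n. SUP t\<in>\<Theta> - ball \<theta> \<delta>. ereal (h n t / real n)) < ereal 0"
        using elim(1) \<delta> unfolding h_def l_def zero_ereal_def[symmetric] by blast
      \<comment> \<open>A real \<open>b\<close> strictly between the limit superior and 0 gives a
        finite rate \<open>c = - b\<close>, even if the limit superior is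
        \<open>-\<infinity>\<close>, as when \<Theta> is the ball itself.\<close>
      from ereal_dense2[OF this] obtain b where
        b: "limsup (\<lambda>n. SUP t\<in>\<Theta> - ball \<theta> \<delta>. ereal (h n t / real n)) < ereal b" "b < 0"
        by auto
      have "\<forall>\<^sub>F n in sequentially. \<forall>t\<in>\<Theta> - ball \<theta> \<delta>. h n t \<le> - (- b) * real n"
        using eventually_less_if_limsup_SUP_less[OF b(1)] eventually_gt_at_top[of 0]
        by eventually_elim (auto simp: pos_divide_less_eq intro: less_imp_le)
      then show ?thesis using b(2) by (intro exI[of _ "- b"]) auto
    qed
    have lim: "(\<lambda>n. (LBINT t:\<Theta>. exp (h n t) * p t) / A n) \<longlonglongrightarrow> p \<theta>"
      if "prob_density_on \<Theta> p" "cont_diff_at 4 p \<theta>" for p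
      unfolding A_def
    proof (rule laplace_concentration[OF assms(1) e _ _ lip sep])
      show "continuous_on \<Theta> (h n)" for n
        unfolding h_def l_def by (intro continuous_intros cont elim(2))
    qed (use K that in \<open>auto intro: set_integrable_if_prob_density_on isCont_if_cont_diff_at\<close>)
    \<comment> \<open>The factor \<open>exp (l n \<theta>)\<close> is the same for both priors and
      cancels in the Bayes factor.\<close>
    have marginal: "marginal_likelihood \<Theta> f p n (\<lambda>i. Y i \<omega>) = exp (l n \<theta>) * (LBINT t:\<Theta>. exp (h n t) * p t)"
      for p n
    proof -
      have "marginal_likelihood \<Theta> f p n (\<lambda>i. Y i \<omega>) = (LBINT t:\<Theta>. exp (l n \<theta>) * (exp (h n t) * p t))"
        unfolding marginal_likelihood_def using assms(1) lik[OF elim(2)]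
        by (intro set_lebesgue_integral_cong) (auto simp: l_def h_def exp_diff)
      then show ?thesis by simp
    qed
    have "(\<lambda>n. ((LBINT t:\<Theta>. exp (h n t) * prior\<^sub>1 t) / A n) / ((LBINT t:\<Theta>. exp (h n t) * prior\<^sub>0 t) / A n))
        \<longlonglongrightarrow> prior\<^sub>1 \<theta> / prior\<^sub>0 \<theta>"
      by (intro tendsto_divide lim assms)
    \<comment> \<open>Since division by 0 yields 0, a nonzero quotient also shows that
      \<open>A n\<close> is nonzero, which justifies cancelling it. The limit
      \<open>prior\<^sub>0 \<theta>\<close> is nonzero by assumption.\<close>
    moreover have "\<forall>\<^sub>F n in sequentially. (LBINT t:\<Theta>. exp (h n t) * prior\<^sub>0 t) / A n \<noteq> 0"
      by (rule tendsto_imp_eventually_ne[OF lim]) (use assms in auto)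
    then have "\<forall>\<^sub>F n in sequentially.
        ((LBINT t:\<Theta>. exp (h n t) * prior\<^sub>1 t) / A n) / ((LBINT t:\<Theta>. exp (h n t) * prior\<^sub>0 t) / A n)
        = bayes_factor \<Theta> f prior\<^sub>1 prior\<^sub>0 n (\<lambda>i. Y i \<omega>)"
      by eventually_elim (simp add: bayes_factor_def marginal)
    ultimately show ?case by (rule Lim_transform_eventually)
  qed
qed (use assms in auto)

end
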